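(* As formal power series in $z$ (with coefficients polynomials in $x$ and $q$), \[ \sum_{0\leq k \leq n} S_1[n,k]\, x^k z^n = \cfrac{1}{ 1 - (x-[1]_q)z - \cfrac{[1]_q z}{ 1 - (x-[2]_q)z - \cfrac{[2]_qz}{ 1 - (x-[3]_q)z - \cfrac{[3]_qz}{\ddots} } } }. \]
   Context: $[i]_q=1+q+\dots+q^{i-1}$. For $n\geq 0$ let $\mathfrak{S}_n$ be the set of permutations of $\{1,\dots,n\}$. For $\sigma\in\mathfrak{S}_n$, a right-to-left maximum is an index $i$ such that $\sigma(i)>\sigma(j)$ for all $j$ with $i<j\leq n$; let $\mathrm{rlm}(\sigma)$ be their number. An inversion of $\sigma$ is a pair $(i,j)$ with $1\leq i<j\leq n$ and $\sigma(i)>\sigma(j)$; it is special if there exists $k'$ with $j<k'\leq n$ and $\sigma(i)<\sigma(k')$. Let $\mathrm{inv}'(\sigma)$ be the number of special inversions. For $0\leq k\leq n$, define $S_1[n,k]=\sum_{\sigma} q^{\mathrm{inv}'(\sigma)}$, summed over $\sigma\in\mathfrak{S}_n$ with $\mathrm{rlm}(\sigma)=k$ (so $S_1[0,0]=1$). *)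

theory Defs
  imports "HOL-Computational_Algebra.Computational_Algebra" "HOL-Combinatorics.Permutations"
begin

section \<open>The polynomials $S_1[n,k]$\<close>

text \<open>Polynomials in $q$ are of type \<^typ>\<open>int poly\<close>, with $q$ the polynomial variable.\<close>

definition qvar :: "int poly" where
  "qvar = [:0, 1:]"

definition qint :: "nat \<Rightarrow> int poly" where
  "qint i = (\<Sum>j<i. qvar ^ j)"

text \<open>A permutation of $\{1,\dots,n\}$ is a function \<open>\<sigma>\<close> with
  \<^prop>\<open>\<sigma> permutes {1..n}\<close> (identity outside of \<^term>\<open>{1..n::nat}\<close>).\<close>

definition rlm :: "nat \<Rightarrow> (nat \<Rightarrow> nat) \<Rightarrow> nat" where
  "rlm n \<sigma> = card {i \<in> {1..n}. \<forall>j. i < j \<and> j \<le> n \<longrightarrow> \<sigma> i > \<sigma> j}"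

definition inversions :: "nat \<Rightarrow> (nat \<Rightarrow> nat) \<Rightarrow> (nat \<times> nat) set" where
  "inversions n \<sigma> = {(i, j). 1 \<le> i \<and> i < j \<and> j \<le> n \<and> \<sigma> i > \<sigma> j}"

definition special_inversions :: "nat \<Rightarrow> (nat \<Rightarrow> nat) \<Rightarrow> (nat \<times> nat) set" where
  "special_inversions n \<sigma> =
     {(i, j) \<in> inversions n \<sigma>. \<exists>k'. j < k' \<and> k' \<le> n \<and> \<sigma> i < \<sigma> k'}"

definition inv' :: "nat \<Rightarrow> (nat \<Rightarrow> nat) \<Rightarrow> nat" where
  "inv' n \<sigma> = card (special_inversions n \<sigma>)"

definition S1 :: "nat \<Rightarrow> nat \<Rightarrow> int poly" where
  "S1 n k = (\<Sum>\<sigma> | \<sigma> permutes {1..n} \<and> rlm n \<sigma> = k. qvar ^ inv' n \<sigma>)"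

text \<open>Polynomials in $x$ and $q$ are of type \<^typ>\<open>int poly poly\<close>: the outer variable is $x$,
  and polynomials in $q$ are embedded as constants \<open>[:p:]\<close>. The variable $z$ is \<^const>\<open>fps_X\<close>.\<close>

definition xvar :: "int poly poly" where
  "xvar = [:0, 1:]"


section \<open>The continued fraction\<close>

text \<open>Since \<^typ>\<open>int poly poly\<close> is not a field, the library operation \<^const>\<open>inverse\<close> on formal
  power series is not available. A power series over a commutative ring whose constant coefficient
  is $1$ is nevertheless invertible, and its inverse is the one-sided inverse of the library.\<close>

definition fps_recip :: "'a::comm_ring_1 fps \<Rightarrow> 'a fps" where
  "fps_recip f = fps_right_inverse f 1"

lemma fps_recip: "f * fps_recip f = 1" if "fps_nth f 0 = 1" for f :: "'a::comm_ring_1 fps"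
  using that fps_right_inverse[of f 1] by (simp add: fps_recip_def)

text \<open>\<open>contfrac N b a i\<close> is the finite continued fraction with \<open>N\<close> levels
  \[
    \cfrac{1}{b_i - \cfrac{a_i}{b_{i+1} - \cfrac{a_{i+1}}{\ddots - \cfrac{a_{i+N-2}}{b_{i+N-1}}}}}
  \]
  that is, the infinite continued fraction starting at index \<open>i\<close>, cut off by replacing the
  quotient with numerator $a_{i+N-1}$ by $0$.\<close>

primrec contfrac ::
  "nat \<Rightarrow> (nat \<Rightarrow> 'a::comm_ring_1 fps) \<Rightarrow> (nat \<Rightarrow> 'a fps) \<Rightarrow> nat \<Rightarrow> 'a fps"
where
  "contfrac 0 b a i = 0"
| "contfrac (Suc N) b a i = fps_recip (b i - a i * contfrac N b a (Suc i))"

text \<open>An infinite continued fraction has value \<open>F\<close> if its convergents tend to \<open>F\<close> in the $z$-adic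
  topology, which is the topology that the library puts on formal power series.\<close>

definition has_contfrac ::
  "'a::comm_ring_1 fps \<Rightarrow> (nat \<Rightarrow> 'a fps) \<Rightarrow> (nat \<Rightarrow> 'a fps) \<Rightarrow> nat \<Rightarrow> bool"
where
  "has_contfrac F b a i \<longleftrightarrow> (\<lambda>N. contfrac N b a i) \<longlonglongrightarrow> F"

end

theory Submission
  imports Defs "HOL-Combinatorics.Multiset_Permutations"
begin

text \<open>Read \<open>\<sigma>\<close> from right to left and record at each time the number \<open>m\<close> of unread letters below
  the current maximum. A right-to-left maximum changes \<open>m\<close> to some \<open>m + g\<close> with $g \ge 0$. Any other
  letter lowers \<open>m\<close> by one, and the number of special inversions in which it is the right entry is
  the number of unread letters between it and the maximum, so that the $m$ choices of that letter
  contribute $[m]_q$ in total. Hence $\sum_k S_1[n,k] x^k$ counts weighted Lukasiewicz paths of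
  length \<open>n\<close> from \<open>0\<close> to \<open>0\<close>. Let $H_0 = 1$ and, for $i \ge 1$, let $H_i$ be the generating
  function of the paths from \<open>0\<close> that end below height \<open>i\<close>. Splitting off the last step gives
  $H_i - H_{i-1} = z (x H_i + [i]_q (H_{i+1} - H_i))$, which is the three-term recurrence of the
  continued fraction. Its value is therefore $H_1/H_0 = H_1$, the generating function of the
  paths from \<open>0\<close> to \<open>0\<close>.\<close>

section \<open>Evaluation of continued fractions\<close>

text \<open>Convergents and exact tails obey the same recursion, so each level multiplies the error
  by a multiple of \<open>a i\<close>, hence by a further factor z.\<close>

lemma fps_X_power_dvd_contfrac_diff:
  fixes a b G :: "nat \<Rightarrow> 'a::comm_ring_1 fps"
  assumes b: "\<And>j. j \<ge> i \<Longrightarrow> fps_nth (b j) 0 = 1"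
    and a: "\<And>j. j \<ge> i \<Longrightarrow> fps_X dvd a j"
    and G: "\<And>j. j \<ge> i \<Longrightarrow> G j * (b j - a j * G (Suc j)) = 1"
  shows "fps_X ^ N dvd contfrac N b a i - G i"
  using assms
proof (induction N arbitrary: i)
  case 0
  then show ?case by simp
next
  case (Suc N)
  let ?C = "contfrac N b a (Suc i)"
  let ?d = "b i - a i * ?C"
  have IH: "fps_X ^ N dvd ?C - G (Suc i)"
    using Suc.prems by (intro Suc.IH) auto
  have aX: "fps_X dvd a i"
    using Suc.prems by simp
  then have "fps_nth (a i) 0 = 0"
    by (auto elim!: dvdE)
  then have "fps_nth ?d 0 = 1"
    using Suc.prems(1)[of i] by simp
  then have d: "?d * fps_recip ?d = 1"
    by (rule fps_recip)
  \<comment> \<open>Each term is multiplied by an expression equal to 1, chosen so that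
    \<open>b i\<close> cancels.\<close>
  have "fps_recip ?d - G i = fps_recip ?d * (G i * (b i - a i * G (Suc i))) - G i * (?d * fps_recip ?d)"
    using Suc.prems(3)[of i] d by simp
  also have "\<dots> = fps_recip ?d * G i * (a i * (?C - G (Suc i)))"
    by (simp add: algebra_simps)
  finally show ?case
    using mult_dvd_mono[OF aX IH] by simp
qed

lemma LIMSEQ_fpsI:
  fixes f :: "'a::comm_ring_1 fps"
  assumes "\<And>N. fps_X ^ N dvd s N - f"
  shows "s \<longlonglongrightarrow> f"
proof (rule metric_LIMSEQ_I)
  fix r :: real
  assume "r > 0"
  then obtain N where N: "(1/2) ^ N < r"
    using real_arch_pow_inv[of r "1/2"] by auto
  have "dist (s n) f < r" if "n \<ge> N" for n
  proof (cases "s n = f")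
    case False
    have "subdegree (s n - f) \<ge> n"
    proof (rule subdegree_geI)
      show "s n - f \<noteq> 0" using False by simp
      show "fps_nth (s n - f) i = 0" if "i < n" for i
      proof -
        obtain g where "s n - f = fps_X ^ n * g" using assms[of n] by (rule dvdE)
        then show ?thesis using that by (simp only: fps_X_power_mult_nth) simp
      qed
    qed
    then have "(1/2) ^ subdegree (s n - f) \<le> (1/2 :: real) ^ N"
      using \<open>n \<ge> N\<close> by (intro power_decreasing) auto
    moreover have "dist (s n) f = (1/2) ^ subdegree (s n - f)"
      using False by (simp add: dist_fps_def power_one_over inverse_eq_divide)
    ultimately have "dist (s n) f \<le> (1/2) ^ N" by simp
    with N show ?thesis by simp
  qed (use \<open>r > 0\<close> in simp)
  then show "\<exists>no. \<forall>n\<ge>no. dist (s n) f < r" by blast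
qed

text \<open>A solution \<open>H\<close> of the three-term recurrence makes the quotients $H_i/H_{i-1}$ satisfy the
  functional equations of the tails of the continued fraction.\<close>

lemma has_contfrac_three_term:
  fixes a b H :: "nat \<Rightarrow> 'a::comm_ring_1 fps"
  assumes b: "\<And>i. fps_nth (b (Suc i)) 0 = 1"
    and a: "\<And>i. fps_X dvd a (Suc i)"
    and H0: "\<And>i. fps_nth (H i) 0 = 1"
    and H: "\<And>i. H i = b (Suc i) * H (Suc i) - a (Suc i) * H (Suc (Suc i))"
    and H_0: "H 0 = 1"
  shows "has_contfrac (H 1) b a 1"
proof -
  define R where "R i = fps_recip (H i)" for i
  have R: "H i * R i = 1" for i
    using fps_recip[OF H0] by (simp add: R_def)
  define G where "G i = H i * R (i - 1)" for i
  have G: "G j * (b j - a j * G (Suc j)) = 1" if "j \<ge> 1" for j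
  proof -
    from that obtain i where j: "j = Suc i" by (cases j) simp_all
    have "G j * (b j - a j * G (Suc j)) =
      R i * (b j * H j - a j * H (Suc j) * (H j * R j))"
      by (simp add: G_def j algebra_simps)
    also have "\<dots> = 1"
      using R[of i] H[of i] by (simp add: R j mult.commute)
    finally show ?thesis .
  qed
  have ba: "fps_nth (b j) 0 = 1" "fps_X dvd a j" if "j \<ge> 1" for j
    using b[of "j - 1"] a[of "j - 1"] that by simp_all
  have "fps_X ^ N dvd contfrac N b a 1 - G 1" for N
    by (intro fps_X_power_dvd_contfrac_diff ba G)
  then have "(\<lambda>N. contfrac N b a 1) \<longlonglongrightarrow> G 1"
    by (rule LIMSEQ_fpsI)
  moreover have "G 1 = H 1"
    using R[of 0] H_0 by (simp add: G_def)
  ultimately show ?thesis by (simp add: has_contfrac_def)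
qed

section \<open>Weighted Lukasiewicz paths\<close>

definition qsum :: "'a::comm_ring_1 \<Rightarrow> nat \<Rightarrow> 'a" where
  "qsum q m = (\<Sum>j<m. q ^ j)"

lemma qsum_0 [simp]: "qsum q 0 = 0"
  by (simp add: qsum_def)

text \<open>A path stays at nonnegative heights. A step to a height at least as large has weight \<open>x\<close>, a
  step from height \<open>m\<close> to height \<open>m - 1\<close> has weight $[m]_q$, and there are no other steps.
  The sum in the definition of \<open>paths_to_0\<close> stops at \<open>n\<close> because \<open>n\<close> steps cannot lead to \<open>0\<close>
  from a greater height.\<close>

primrec paths_to_0 :: "'a::comm_ring_1 \<Rightarrow> 'a \<Rightarrow> nat \<Rightarrow> nat \<Rightarrow> 'a" where
  "paths_to_0 x q 0 m = (if m = 0 then 1 else 0)"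
| "paths_to_0 x q (Suc n) m =
     x * (\<Sum>k=m..n. paths_to_0 x q n k) + qsum q m * paths_to_0 x q n (m - 1)"

text \<open>Here the last step is split off, in \<open>paths_to_0\<close> the first one.\<close>

primrec paths_from_0 :: "'a::comm_ring_1 \<Rightarrow> 'a \<Rightarrow> nat \<Rightarrow> nat \<Rightarrow> 'a" where
  "paths_from_0 x q 0 m = (if m = 0 then 1 else 0)"
| "paths_from_0 x q (Suc n) m =
     x * (\<Sum>k\<le>m. paths_from_0 x q n k) + qsum q (Suc m) * paths_from_0 x q n (Suc m)"

text \<open>Both sides count the paths of \<open>k + 1 + l\<close> steps
  from \<open>0\<close> to \<open>0\<close>, by their height after \<open>k + 1\<close> and after \<open>k\<close> steps respectively.\<close>

lemma paths_shift:
  "(\<Sum>m\<le>l. paths_from_0 x q (Suc k) m * paths_to_0 x q l m) =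
   (\<Sum>m\<le>Suc l. paths_from_0 x q k m * paths_to_0 x q (Suc l) m)"
proof -
  let ?A = "paths_to_0 x q" and ?B = "paths_from_0 x q"
  \<comment> \<open>Both sums range over j \<le> m \<le> l; the index \<open>Suc l\<close> only adds
    an empty inner sum.\<close>
  have up: "(\<Sum>m\<le>l. (\<Sum>j\<le>m. ?B k j) * ?A l m) = (\<Sum>j\<le>Suc l. ?B k j * (\<Sum>m=j..l. ?A l m))"
  proof -
    have "(\<Sum>m\<le>l. (\<Sum>j\<le>m. ?B k j) * ?A l m) =
      (\<Sum>m\<in>{..l}. \<Sum>j\<in>{j \<in> {..Suc l}. j \<le> m}. ?B k j * ?A l m)"
      by (auto simp: sum_distrib_right intro!: sum.cong)
    also have "\<dots> = (\<Sum>j\<in>{..Suc l}. \<Sum>m\<in>{m \<in> {..l}. j \<le> m}. ?B k j * ?A l m)"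
      by (rule sum.swap_restrict) auto
    also have "\<dots> = (\<Sum>j\<le>Suc l. ?B k j * (\<Sum>m=j..l. ?A l m))"
      unfolding sum_distrib_left by (intro sum.cong) auto
    finally show ?thesis .
  qed
  \<comment> \<open>The new term m = 0 vanishes because \<open>qsum q 0 = 0\<close>, so the
    truncated \<open>0 - 1\<close> does no harm.\<close>
  have down: "(\<Sum>m\<le>l. qsum q (Suc m) * ?B k (Suc m) * ?A l m) =
    (\<Sum>m\<le>Suc l. ?B k m * (qsum q m * ?A l (m - 1)))"
    by (subst sum.atMost_Suc_shift) (simp add: mult_ac)
  have "(\<Sum>m\<le>l. ?B (Suc k) m * ?A l m) =
    x * (\<Sum>m\<le>l. (\<Sum>j\<le>m. ?B k j) * ?A l m) + (\<Sum>m\<le>l. qsum q (Suc m) * ?B k (Suc m) * ?A l m)"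
    by (simp add: distrib_right sum.distrib mult.assoc flip: sum_distrib_left)
  also have "\<dots> = (\<Sum>m\<le>Suc l. ?B k m * ?A (Suc l) m)"
    unfolding up down
    by (simp add: distrib_left sum.distrib sum_distrib_left mult_ac del: sum.atMost_Suc)
  finally show ?thesis .
qed

text \<open>By \<open>paths_shift\<close>, the point that cuts a path into \<open>k\<close> and
  \<open>l\<close> steps can be moved back to the start. A cut at the end leaves the left-hand
  side.\<close>

lemma paths_from_0_eq_to_0: "paths_from_0 x q n 0 = paths_to_0 x q n 0"
proof -
  have "(\<Sum>m\<le>l. paths_from_0 x q k m * paths_to_0 x q l m) = paths_to_0 x q (k + l) 0" for k l
  proof (induction k arbitrary: l)
    case 0
    have "(\<Sum>m\<le>l. paths_from_0 x q 0 m * paths_to_0 x q l m) =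
      (\<Sum>m\<in>{..l}. if m = 0 then paths_to_0 x q l m else 0)"
      by (intro sum.cong) auto
    then show ?case by simp
  next
    case (Suc k)
    show ?case unfolding paths_shift Suc.IH by (simp only: add_Suc add_Suc_right)
  qed
  from this[of n 0] show ?thesis by simp
qed

text \<open>The series H_i. H_0 is 1 rather than an empty sum so that H_1 - H_0 omits the empty
  path, which has no last step to split off.\<close>

primrec cumulative_paths :: "'a::comm_ring_1 \<Rightarrow> 'a \<Rightarrow> nat \<Rightarrow> 'a fps" where
  "cumulative_paths x q 0 = 1"
| "cumulative_paths x q (Suc i) = Abs_fps (\<lambda>n. \<Sum>m\<le>i. paths_from_0 x q n m)"

lemma cumulative_paths_recurrence:
  "cumulative_paths x q i =
     (1 - fps_const (x - qsum q (Suc i)) * fps_X) * cumulative_paths x q (Suc i)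
     - fps_const (qsum q (Suc i)) * fps_X * cumulative_paths x q (Suc (Suc i))"
proof (rule fps_ext)
  fix n
  let ?B = "paths_from_0 x q"
  show "fps_nth (cumulative_paths x q i) n = fps_nth
    ((1 - fps_const (x - qsum q (Suc i)) * fps_X) * cumulative_paths x q (Suc i)
     - fps_const (qsum q (Suc i)) * fps_X * cumulative_paths x q (Suc (Suc i))) n"
  proof (cases n)
    case 0
    have "(\<Sum>m\<le>i. ?B 0 m) = 1" for i by simp
    with 0 show ?thesis by (cases i) (simp_all add: mult.assoc left_diff_distrib)
  next
    case (Suc k)
    \<comment> \<open>For i = 0 both sides are 0, the left one as a higher coefficient of the series
      1.\<close>
    have "fps_nth (cumulative_paths x q i) (Suc k) = (\<Sum>m\<le>i. ?B (Suc k) m) - ?B (Suc k) i"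
      by (cases i) simp_all
    then show ?thesis
      by (simp add: Suc mult.assoc left_diff_distrib) (simp add: algebra_simps)
  qed
qed

lemma has_contfrac_paths:
  "has_contfrac (Abs_fps (\<lambda>n. paths_to_0 x q n 0))
     (\<lambda>i. 1 - fps_const (x - qsum q i) * fps_X) (\<lambda>i. fps_const (qsum q i) * fps_X) 1"
proof -
  have "fps_nth (cumulative_paths x q i) 0 = 1" for i
    by (cases i) simp_all
  then have "has_contfrac (cumulative_paths x q 1)
     (\<lambda>i. 1 - fps_const (x - qsum q i) * fps_X) (\<lambda>i. fps_const (qsum q i) * fps_X) 1"
    by (intro has_contfrac_three_term cumulative_paths_recurrence) simp_all
  then show ?thesis by (simp add: paths_from_0_eq_to_0)
qed

section \<open>Permutations as paths\<close>

text \<open>Here \<open>M\<close> is the maximum of the letters already read, so \<open>v > M\<close> is a new record.\<close>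

primrec word_weight :: "'a::comm_ring_1 \<Rightarrow> 'a \<Rightarrow> 'b::linorder \<Rightarrow> 'b list \<Rightarrow> 'a" where
  "word_weight x q M [] = 1"
| "word_weight x q M (v # vs) =
     (if M < v then x else 1) * q ^ card {u \<in> set vs. v < u \<and> u < M} * word_weight x q (max M v) vs"

text \<open>Ranks in a finite chain take each value below its size once: removing the maximum leaves
  the other ranks unchanged.\<close>

lemma sum_card_less:
  fixes f :: "nat \<Rightarrow> 'a::comm_monoid_add" and S :: "'b::linorder set"
  assumes "finite S"
  shows "(\<Sum>v\<in>S. f (card {u \<in> S. u < v})) = (\<Sum>k<card S. f k)"
  using assms
proof (induction rule: finite_linorder_max_induct)
  case (insert b A)
  have "b \<notin> A" using insert by auto
  have "{u \<in> insert b A. u < b} = A" using insert by auto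
  moreover have "{u \<in> insert b A. u < v} = {u \<in> A. u < v}" if "v \<in> A" for v
    using insert that by force
  ultimately show ?case
    using insert \<open>b \<notin> A\<close> by (simp add: add.commute)
qed simp

lemma sum_card_greater:
  fixes f :: "nat \<Rightarrow> 'a::comm_monoid_add" and S :: "'b::linorder set"
  assumes "finite S"
  shows "(\<Sum>v\<in>S. f (card {u \<in> S. v < u})) = (\<Sum>k<card S. f k)"
  using assms
proof (induction rule: finite_linorder_min_induct)
  case (insert b A)
  have "b \<notin> A" using insert by auto
  have "{u \<in> insert b A. b < u} = A" using insert by auto
  moreover have "{u \<in> insert b A. v < u} = {u \<in> A. v < u}" if "v \<in> A" for v
    using insert that by force
  ultimately show ?case
    using insert \<open>b \<notin> A\<close> by (simp add: add.commute)
qed simp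

lemma sum_word_weight_Cons:
  assumes "finite U" "U \<noteq> {}"
  shows "(\<Sum>vs\<in>permutations_of_set U. word_weight x q M vs) =
    (\<Sum>v\<in>U. (if M < v then x else 1) * q ^ card {u \<in> U. v < u \<and> u < M} *
      (\<Sum>vs\<in>permutations_of_set (U - {v}). word_weight x q (max M v) vs))"
proof -
  have "(\<Sum>vs\<in>permutations_of_set U. word_weight x q M vs) =
    (\<Sum>v\<in>U. \<Sum>vs\<in>(#) v ` permutations_of_set (U - {v}). word_weight x q M vs)"
    unfolding permutations_of_set_nonempty[OF assms(2)]
    using assms(1) by (intro sum.UNION_disjoint) auto
  also have "\<dots> = (\<Sum>v\<in>U. \<Sum>vs\<in>permutations_of_set (U - {v}). word_weight x q M (v # vs))"
    by (rule sum.cong[OF refl], subst sum.reindex) auto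
  also have "\<dots> = (\<Sum>v\<in>U. (if M < v then x else 1) * q ^ card {u \<in> U. v < u \<and> u < M} *
      (\<Sum>vs\<in>permutations_of_set (U - {v}). word_weight x q (max M v) vs))"
    unfolding sum_distrib_left
  proof (intro sum.cong refl)
    fix v vs assume "vs \<in> permutations_of_set (U - {v})"
    then have "{u \<in> set vs. v < u \<and> u < M} = {u \<in> U. v < u \<and> u < M}"
      by (auto dest: permutations_of_setD)
    then show "word_weight x q M (v # vs) =
      (if M < v then x else 1) * q ^ card {u \<in> U. v < u \<and> u < M} * word_weight x q (max M v) vs"
      by simp
  qed
  finally show ?thesis .
qed

text \<open>A first letter below \<open>M\<close> is weighted by its rank from above, and these
  ranks sum to the q-integer. A first letter above \<open>M\<close> is a record and raises the
  height by its rank among such letters.\<close>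

lemma sum_word_weight:
  assumes "finite U" "M \<notin> U"
  shows "(\<Sum>vs\<in>permutations_of_set U. word_weight x q M vs) =
    paths_to_0 x q (card U) (card {u \<in> U. u < M})"
  using assms
proof (induction "card U" arbitrary: U M)
  case 0
  then show ?case by simp
next
  case (Suc n)
  define L where "L = {u \<in> U. u < M}"
  define R where "R = {u \<in> U. M < u}"
  let ?A = "paths_to_0 x q"
  have fin: "finite L" "finite R" using Suc.prems by (auto simp: L_def R_def)
  have U: "U = L \<union> R" "L \<inter> R = {}"
    using Suc.prems by (auto simp: L_def R_def) (metis neqE)
  have card_U: "Suc n = card L + card R"
    using card_Un_disjoint[OF fin U(2)] U(1) Suc.hyps by simp
  define T where "T v = (if M < v then x else 1) * q ^ card {u \<in> U. v < u \<and> u < M} *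
      (\<Sum>vs\<in>permutations_of_set (U - {v}). word_weight x q (max M v) vs)" for v
  have IH: "(\<Sum>vs\<in>permutations_of_set (U - {v}). word_weight x q (max M v) vs) =
    ?A n (card {u \<in> U - {v}. u < max M v})" if "v \<in> U" for v
  proof -
    have "n = card (U - {v})" using Suc that by simp
    then show ?thesis
      using Suc.hyps(1)[of "U - {v}" "max M v"] Suc.prems by (simp add: max_def)
  qed
  have TL: "T v = q ^ card {u \<in> L. v < u} * ?A n (card L - 1)" if "v \<in> L" for v
  proof -
    have "v \<in> U" "v < M" using that by (auto simp: L_def)
    have "{u \<in> U. v < u \<and> u < M} = {u \<in> L. v < u}" by (auto simp: L_def)
    moreover have "{u \<in> U - {v}. u < M} = L - {v}" by (auto simp: L_def)
    ultimately show ?thesis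
      unfolding T_def IH[OF \<open>v \<in> U\<close>] using \<open>v < M\<close> that fin
      by (simp add: max_absorb1 less_not_sym)
  qed
  have TR: "T v = x * ?A n (card L + card {u \<in> R. u < v})" if "v \<in> R" for v
  proof -
    have "v \<in> U" "M < v" using that by (auto simp: R_def)
    have "{u \<in> U - {v}. u < v} = L \<union> {u \<in> R. u < v}"
      using U \<open>M < v\<close> by (auto simp: L_def)
    moreover have "L \<inter> {u \<in> R. u < v} = {}" using U by auto
    ultimately have "card {u \<in> U - {v}. u < v} = card L + card {u \<in> R. u < v}"
      using fin by (simp add: card_Un_disjoint)
    moreover have none: "{u \<in> U. v < u \<and> u < M} = {}" using \<open>M < v\<close> by auto
    ultimately show ?thesis
      unfolding T_def IH[OF \<open>v \<in> U\<close>] none using \<open>M < v\<close> by (simp add: max_absorb2)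
  qed
  have "U \<noteq> {}" using Suc.hyps by auto
  then have "(\<Sum>vs\<in>permutations_of_set U. word_weight x q M vs) = (\<Sum>v\<in>U. T v)"
    unfolding T_def by (rule sum_word_weight_Cons[OF Suc.prems(1)])
  also have "\<dots> = (\<Sum>v\<in>R. T v) + (\<Sum>v\<in>L. T v)"
    using sum.union_disjoint[OF fin U(2)] U(1) by (simp add: add.commute)
  also have "(\<Sum>v\<in>L. T v) = (\<Sum>v\<in>L. q ^ card {u \<in> L. v < u}) * ?A n (card L - 1)"
    by (simp add: TL sum_distrib_right)
  also have "\<dots> = qsum q (card L) * ?A n (card L - 1)"
    by (simp add: sum_card_greater[OF fin(1)] qsum_def)
  also have "(\<Sum>v\<in>R. T v) = x * (\<Sum>v\<in>R. ?A n (card L + card {u \<in> R. u < v}))"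
    by (simp add: TR sum_distrib_left)
  also have "\<dots> = x * (\<Sum>k<card R. ?A n (card L + k))"
    by (simp add: sum_card_less[OF fin(2), of "\<lambda>k. ?A n (card L + k)"])
  \<comment> \<open>As \<open>card L + card R = Suc n\<close>, records lead to the heights
    \<open>card L\<close> up to \<open>n\<close>.\<close>
  also have "(\<Sum>k<card R. ?A n (card L + k)) = (\<Sum>k=card L..n. ?A n k)"
    using card_U by (intro sum.reindex_bij_witness[of _ "\<lambda>k. k - card L" "\<lambda>k. card L + k"]) auto
  finally show ?case
    by (simp flip: L_def Suc.hyps(2))
qed

text \<open>Reversal turns reading from right to left into list recursion. Both sets have n!
  elements, so injectivity yields surjectivity.\<close>

lemma rev_map_permutes_bij_betw:
  "bij_betw (\<lambda>\<sigma>. rev (map \<sigma> [1..<Suc n])) {\<sigma>. \<sigma> permutes {1..n}} (permutations_of_set {1..n})"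
proof -
  let ?f = "\<lambda>\<sigma>. rev (map \<sigma> [1..<Suc n]) :: nat list"
  have set_upt: "set [1..<Suc n] = {1..n}" by auto
  have inj: "inj_on ?f {\<sigma>. \<sigma> permutes {1..n}}"
  proof (rule inj_onI)
    fix \<sigma> \<tau> assume *: "\<sigma> \<in> {\<sigma>. \<sigma> permutes {1..n}}" "\<tau> \<in> {\<sigma>. \<sigma> permutes {1..n}}" "?f \<sigma> = ?f \<tau>"
    then have "\<sigma> i = \<tau> i" if "i \<in> {1..n}" for i
      using that unfolding rev_is_rev_conv map_eq_conv set_upt by blast
    moreover have "\<sigma> i = \<tau> i" if "i \<notin> {1..n}" for i
      using that * by (simp add: permutes_not_in)
    ultimately show "\<sigma> = \<tau>" by blast
  qed
  moreover have "?f ` {\<sigma>. \<sigma> permutes {1..n}} = permutations_of_set {1..n}"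
  proof (rule card_subset_eq)
    show "?f ` {\<sigma>. \<sigma> permutes {1..n}} \<subseteq> permutations_of_set {1..n}"
    proof safe
      fix \<sigma> assume \<sigma>: "\<sigma> permutes {1..n}"
      show "?f \<sigma> \<in> permutations_of_set {1..n}"
      proof
        show "set (?f \<sigma>) = {1..n}"
          unfolding set_rev set_map set_upt using \<sigma> by (rule permutes_image)
        show "distinct (?f \<sigma>)"
          unfolding distinct_rev distinct_map using permutes_inj[OF \<sigma>]
          by (auto intro: inj_on_subset)
      qed
    qed
    show "card (?f ` {\<sigma>. \<sigma> permutes {1..n}}) = card (permutations_of_set {1..n})"
      using inj by (simp add: card_image card_permutations)
  qed simp
  ultimately show ?thesis by (simp add: bij_betw_def)
qed

text \<open>The induction needs the state after positions t+1 to n are read; 0 stands for the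
  maximum of no letters.\<close>

lemma word_weight_rev_map:
  assumes \<sigma>: "\<sigma> permutes {1..n}" and "t \<le> n"
  shows "word_weight x q (Max (insert 0 (\<sigma> ` {Suc t..n}))) (rev (map \<sigma> [1..<Suc t])) =
    (\<Prod>j=1..t. (if \<forall>k. j < k \<and> k \<le> n \<longrightarrow> \<sigma> j > \<sigma> k then x else 1) *
      q ^ card {i. (i, j) \<in> special_inversions n \<sigma>})"
  using \<open>t \<le> n\<close>
proof (induction t)
  case 0
  then show ?case by simp
next
  case (Suc t)
  let ?S = "\<sigma> ` {Suc (Suc t)..n}"
  let ?M = "Max (insert 0 ?S)" and ?vs = "rev (map \<sigma> [1..<Suc t])" and ?v = "\<sigma> (Suc t)"
  have vs: "rev (map \<sigma> [1..<Suc (Suc t)]) = ?v # ?vs" by simp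
  have "{Suc t..n} = insert (Suc t) {Suc (Suc t)..n}" using Suc.prems by auto
  then have M: "max ?M ?v = Max (insert 0 (\<sigma> ` {Suc t..n}))"
    by (simp add: insert_commute[of 0] max.commute)
  \<comment> \<open>Since letters are positive, the inserted 0 does not affect the record
    test.\<close>
  have "?v \<in> {1..n}"
    using permutes_in_image[OF \<sigma>, of "Suc t"] Suc.prems by simp
  then have rec: "?M < ?v \<longleftrightarrow> (\<forall>k. Suc t < k \<and> k \<le> n \<longrightarrow> ?v > \<sigma> k)"
    by (auto simp del: Max_insert)
  \<comment> \<open>Some letter further right exceeds \<open>\<sigma> i\<close> exactly when their
    maximum \<open>?M\<close> does.\<close>
  have "{i. (i, Suc t) \<in> special_inversions n \<sigma>} = {i \<in> {1..t}. ?v < \<sigma> i \<and> \<sigma> i < ?M}"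
    using Suc.prems
    by (auto simp: special_inversions_def inversions_def Max_gr_iff Suc_le_eq simp del: Max_insert)
  moreover have "set ?vs = \<sigma> ` {1..t}" by auto
  ultimately have "{u \<in> set ?vs. ?v < u \<and> u < ?M} = \<sigma> ` {i. (i, Suc t) \<in> special_inversions n \<sigma>}"
    by (simp only: Compr_image_eq)
  then have "card {u \<in> set ?vs. ?v < u \<and> u < ?M} = card {i. (i, Suc t) \<in> special_inversions n \<sigma>}"
    using permutes_inj[OF \<sigma>] by (simp add: card_image inj_on_subset)
  then show ?case
    using Suc unfolding vs word_weight.simps M rec by (simp add: mult.commute)
qed

lemma word_weight_permutes:
  assumes \<sigma>: "\<sigma> permutes {1..n}"
  shows "word_weight x q 0 (rev (map \<sigma> [1..<Suc n])) = x ^ rlm n \<sigma> * q ^ inv' n \<sigma>"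
proof -
  let ?R = "\<lambda>j. \<forall>k. j < k \<and> k \<le> n \<longrightarrow> \<sigma> j > \<sigma> k"
  let ?I = "\<lambda>j. {i. (i, j) \<in> special_inversions n \<sigma>}"
  have fin: "finite (?I j)" for j
    by (rule finite_subset[of _ "{..n}"]) (auto simp: special_inversions_def inversions_def)
  \<comment> \<open>Special inversions are grouped by their right entry, the position being
    read.\<close>
  have "special_inversions n \<sigma> = (\<lambda>(j, i). (i, j)) ` (SIGMA j:{1..n}. ?I j)"
    by (auto simp: special_inversions_def inversions_def image_iff)
  moreover have "inj_on (\<lambda>(j, i). (i, j)) (SIGMA j:{1..n}. ?I j)"
    by (auto simp: inj_on_def)
  ultimately have "inv' n \<sigma> = card (SIGMA j:{1..n}. ?I j)"
    unfolding inv'_def by (metis card_image)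
  then have inv': "inv' n \<sigma> = (\<Sum>j=1..n. card (?I j))"
    using fin by simp
  have "word_weight x q 0 (rev (map \<sigma> [1..<Suc n])) =
    (\<Prod>j=1..n. (if ?R j then x else 1) * q ^ card (?I j))"
    using word_weight_rev_map[OF \<sigma>, of n x q] by simp
  also have "\<dots> = (\<Prod>j=1..n. if ?R j then x else 1) * q ^ inv' n \<sigma>"
    by (simp add: prod.distrib inv' power_sum)
  also have "(\<Prod>j=1..n. if ?R j then x else 1) = x ^ rlm n \<sigma>"
    by (simp add: rlm_def flip: prod.inter_filter)
  finally show ?thesis .
qed

lemma sum_permutes_eq_paths_to_0:
  "(\<Sum>\<sigma> | \<sigma> permutes {1..n}. x ^ rlm n \<sigma> * q ^ inv' n \<sigma>) = paths_to_0 x q n 0"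
proof -
  have "(\<Sum>\<sigma> | \<sigma> permutes {1..n}. x ^ rlm n \<sigma> * q ^ inv' n \<sigma>) =
    (\<Sum>\<sigma> | \<sigma> permutes {1..n}. word_weight x q 0 (rev (map \<sigma> [1..<Suc n])))"
    by (intro sum.cong refl word_weight_permutes[symmetric]) (simp only: mem_Collect_eq)
  also have "\<dots> = (\<Sum>vs\<in>permutations_of_set {1..n}. word_weight x q 0 vs)"
    by (rule sum.reindex_bij_betw[OF rev_map_permutes_bij_betw])
  \<comment> \<open>No letter lies below the initial maximum 0, so the path starts at height
    0.\<close>
  also have "\<dots> = paths_to_0 x q n 0"
    by (subst sum_word_weight) simp_all
  finally show ?thesis .
qed

text \<open>Permutations are grouped by \<open>rlm\<close>, which never exceeds
  \<open>n\<close>.\<close>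

lemma sum_S1_xvar:
  "(\<Sum>k\<le>n. [:S1 n k:] * xvar ^ k) = (\<Sum>\<sigma> | \<sigma> permutes {1..n}. xvar ^ rlm n \<sigma> * [:qvar:] ^ inv' n \<sigma>)"
proof -
  let ?P = "{\<sigma>. \<sigma> permutes {1..n}}"
  have const_power: "[:qvar:] ^ m = [:qvar ^ m:]" for m
    by (simp add: poly_const_pow)
  have const_sum: "[:\<Sum>i\<in>A. g i:] = (\<Sum>i\<in>A. [:g i:])" for g :: "_ \<Rightarrow> int poly" and A :: "(nat \<Rightarrow> nat) set"
    using sum_to_poly[of g A] by simp
  have le: "rlm n \<sigma> \<le> n" for \<sigma>
    unfolding rlm_def by (rule order_trans[OF card_mono[of "{1..n}"]]) auto
  have "(\<Sum>k\<le>n. [:S1 n k:] * xvar ^ k) =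
    (\<Sum>k\<le>n. \<Sum>\<sigma>\<in>{\<sigma> \<in> ?P. rlm n \<sigma> = k}. xvar ^ rlm n \<sigma> * [:qvar:] ^ inv' n \<sigma>)"
    by (intro sum.cong refl) (simp add: S1_def const_sum const_power sum_distrib_right sum_distrib_left mult.commute)
  also have "\<dots> = (\<Sum>\<sigma>\<in>?P. xvar ^ rlm n \<sigma> * [:qvar:] ^ inv' n \<sigma>)"
    using le by (intro sum.group) (auto intro: finite_permutations)
  finally show ?thesis .
qed

lemma qsum_const_poly: "qsum [:qvar:] i = [:qint i:]"
  by (simp add: qsum_def qint_def poly_const_pow sum_to_poly)

theorem theorem5p4:
  shows "has_contfrac
           (Abs_fps (\<lambda>n. \<Sum>k\<le>n. [:S1 n k:] * xvar ^ k))
           (\<lambda>i. 1 - fps_const (xvar - [:qint i:]) * fps_X)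
           (\<lambda>i. fps_const [:qint i:] * fps_X)
           1"
  using has_contfrac_paths[of xvar "[:qvar:]"]
  unfolding sum_S1_xvar sum_permutes_eq_paths_to_0 qsum_const_poly .

end
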